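(* Let $t\geq 1$ and $k\geq 4$ be integers and let $n=t(k-1)+2$. The induced matching number of $\mathrm{GA}(t,k)'$ is $t$, and the number of induced matchings of $\mathrm{GA}(t,k)'$ of size $t$ is exactly $\frac{n}{2}\,(t(k-3)+1)$.
   Context: For integers $t\ge 1$, $k\ge 2$, put $n=t(k-1)+2$. $\mathrm{GA}(t,k)'$ is the simple graph with vertex set $\mathbb Z_n$ in which $a$ and $b$ are adjacent iff $b-a\in\{1+jt \mid j\in\{1,2,\dots,k-2\}\}$ modulo $n$. (This set is closed under negation modulo $n$. Equivalently, for integers $0\le i<j<n$, $\{i,j\}$ is an edge iff $j-i\equiv 1 \pmod t$ and $j-i\notin\{1,n-1\}$.) An induced matching of size $m$ of a graph $G$ is an induced subgraph of $G$ consisting of $m$ pairwise disjoint edges (i.e. an induced subgraph on $2m$ vertices whose only edges are $m$ disjoint ones). The induced matching number is the size of the largest induced matching. *)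

theory Defs
  imports "Graph_Theory.Pair_Digraph" "Graph_Theory.Digraph_Component" "HOL-Library.Disjoint_Sets" "HOL-Number_Theory.Cong"
begin

text \<open>A simple graph is a \<open>pair_graph\<close>: a finite, symmetric, loop-free set of arcs.  Every
  undirected edge is present there as two arcs \<open>(a, b)\<close> and \<open>(b, a)\<close>, so edges have to be
  counted as the sets \<open>{a, b}\<close>.\<close>

definition uedges :: "'a pair_pre_digraph \<Rightarrow> 'a set set" where
  "uedges G = {{a, b} | a b. (a, b) \<in> parcs G}"

definition induced_matching :: "'a pair_pre_digraph \<Rightarrow> nat \<Rightarrow> 'a pair_pre_digraph \<Rightarrow> bool" where
  "induced_matching G m H \<longleftrightarrow>
     induced_subgraph (with_proj H) (with_proj G) \<and>
     pverts H = \<Union> (uedges H) \<and>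
     disjoint (uedges H) \<and>
     finite (uedges H) \<and> card (uedges H) = m"

text \<open>Only meaningful for finite graphs, where the set is finite and contains \<open>0\<close>.\<close>

definition induced_matching_number :: "'a pair_pre_digraph \<Rightarrow> nat" where
  "induced_matching_number G = Max {m. \<exists>H. induced_matching G m H}"

text \<open>\<open>GA' t k\<close> is the graph written \<open>GA(t,k)'\<close>; the vertex set, the integers modulo \<open>n\<close>, is
  represented by the residues \<open>0, \<dots>, n - 1\<close>.\<close>

definition GA' :: "nat \<Rightarrow> nat \<Rightarrow> int pair_pre_digraph" where
  "GA' t k = (let n = int (t * (k - 1) + 2) in
     \<lparr> pverts = {0..<n},
       parcs = {(a, b). a \<in> {0..<n} \<and> b \<in> {0..<n} \<and>
                        (\<exists>j \<in> {1..k - 2}. [b - a = 1 + int j * int t] (mod n))} \<rparr>)"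

lemma pair_graph_GA':
  assumes "t \<ge> 1" "k \<ge> 2"
  shows "pair_graph (GA' t k)"
proof -
  define n where "n = int (t * (k - 1) + 2)"
  define P where "P a b \<longleftrightarrow> (\<exists>j \<in> {1..k - 2}. [b - a = 1 + int j * int t] (mod n))" for a b :: int
  have n: "n = int t * (int k - 1) + 2"
    using assms by (simp add: n_def of_nat_diff)
  have G: "GA' t k = \<lparr> pverts = {0..<n}, parcs = {(a, b). a \<in> {0..<n} \<and> b \<in> {0..<n} \<and> P a b} \<rparr>"
    by (simp add: GA'_def n_def P_def Let_def)
  have symP: "P b a" if "P a b" for a b
  proof -
    from that obtain j where j: "j \<in> {1..k - 2}" "[b - a = 1 + int j * int t] (mod n)"
      by (auto simp: P_def)
    define i where "i = k - 1 - j"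
    have i: "i \<in> {1..k - 2}" using j assms by (auto simp: i_def)
    have ii: "int i = int k - 1 - int j" using j assms by (auto simp: i_def)
    have "n dvd (b - a) - (1 + int j * int t)" using j by (simp add: cong_iff_dvd_diff)
    then have "n dvd - ((b - a) - (1 + int j * int t)) - n" by (metis dvd_diff dvd_minus_iff dvd_refl)
    also have "- ((b - a) - (1 + int j * int t)) - n = (a - b) - (1 + int i * int t)"
      by (simp add: n ii algebra_simps)
    finally show ?thesis using i by (auto simp: P_def cong_iff_dvd_diff)
  qed
  have irr: "\<not> P a a" for a
  proof
    assume "P a a"
    then obtain j where j: "j \<in> {1..k - 2}" "[0 = 1 + int j * int t] (mod n)"
      by (auto simp: P_def)
    then have dvd: "n dvd 1 + int j * int t"
      using cong_dvd_iff dvd_0_right by blast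
    have "int j * int t \<le> (int k - 1) * int t"
      using j by (intro mult_right_mono) auto
    then have "1 + int j * int t < n" by (simp add: n mult.commute)
    moreover have "0 < 1 + int j * int t"
      by (simp add: add_pos_nonneg)
    ultimately show False using zdvd_imp_le[OF dvd] by linarith
  qed
  have fin: "finite (parcs (GA' t k))"
    by (rule finite_subset[of _ "{0..<n} \<times> {0..<n}"]) (auto simp: G)
  show ?thesis
    unfolding pair_graph_def pair_digraph_def pair_pseudo_graph_def pair_fin_digraph_def
      pair_fin_digraph_axioms_def pair_wf_digraph_def pair_loopfree_digraph_def
      pair_loopfree_digraph_axioms_def pair_sym_digraph_def pair_sym_digraph_axioms_def
    using fin symP irr by (auto simp: G sym_def symmetric_def)
qed

end

theory Submission
  imports Defs
begin

text \<open>
  Write \<open>n = t * q + 2\<close> with \<open>q = k - 1\<close>.  The vertices are the corners of an \<open>n\<close>-gon, and two of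
  them are joined when walking from one to the other takes \<open>m\<close> steps with \<open>m \<equiv> 1\<close> modulo \<open>t\<close> and
  the segment between them is not a side.  As \<open>n \<equiv> 2\<close> modulo \<open>t\<close>, the direction of the walk does
  not matter.  Because an induced subgraph is determined by its vertices, an induced matching is
  the same thing as a set \<open>V\<close> of vertices in which each vertex has exactly one neighbour.

  \<^emph>\<open>At most \<open>t\<close> edges.\<close>  Every vertex has \<open>k - 2 \<ge> 2\<close> neighbours in the whole graph, so \<open>V\<close> misses a
  vertex, and after a rotation it misses \<open>0\<close>.  Then differences inside \<open>V\<close> are less than \<open>n - 1\<close>, so
  \<open>x < y\<close> in \<open>V\<close> are adjacent if and only if \<open>y - x \<equiv> 1\<close> modulo \<open>t\<close> and \<open>y \<noteq> x + 1\<close>.  If the lower endpoints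
  \<open>a < a'\<close> of two edges were congruent modulo \<open>t\<close>, then \<open>a\<close> would be adjacent to the upper endpoint of
  the edge at \<open>a'\<close>, which lies beyond \<open>a' > a\<close>.  So the lower endpoints have distinct residues.

  \<^emph>\<open>Shape of the matchings with \<open>t\<close> edges.\<close>  Now the set \<open>L\<close> of lower endpoints hits every residue
  exactly once.  Two elements of \<open>L\<close> are not adjacent, so when one climbs from an element of \<open>L\<close> to a
  larger one of the next residue, the step is exactly \<open>1\<close>.  Starting from the minimum, this forces
  \<open>L\<close> to be a run of \<open>t\<close> consecutive numbers, and the same holds for the upper endpoints.  The two
  runs cannot touch: the vertices facing each other at the contact would have to be matched, but
  they span a side.  Conversely, two runs of length \<open>t\<close> with gaps on both sides always induce a
  matching, since each residue class meets each run once (\<open>full_matching_iff\<close>).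

  \<^emph>\<open>Counting.\<close>  Such a set is determined by the first vertices \<open>i\<close> and \<open>i + d\<close> of its two runs, and these
  can be recovered from it; the only condition is \<open>t + 1 \<le> d \<le> n - t - 1\<close>.  So the number is that of
  unordered pairs at such a distance, \<open>n * (n - 2 * t - 1) / 2\<close>, and
  \<open>n - 2 * t - 1 = t * (k - 3) + 1\<close>.
\<close>

section \<open>Induced matchings as vertex sets\<close>

definition induces_matching :: "('a \<Rightarrow> 'a \<Rightarrow> bool) \<Rightarrow> 'a set \<Rightarrow> bool" where
  "induces_matching E V \<longleftrightarrow> (\<forall>v\<in>V. \<exists>!w. w \<in> V \<and> E v w)"

lemma induces_matching_image:
  assumes "inj_on f V" and "\<And>x y. x \<in> V \<Longrightarrow> y \<in> V \<Longrightarrow> E (f x) (f y) \<longleftrightarrow> E x y"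
  shows "induces_matching E (f ` V) \<longleftrightarrow> induces_matching E V"
proof -
  have "(\<exists>!w. w \<in> f ` V \<and> E (f v) w) \<longleftrightarrow> (\<exists>!w. w \<in> V \<and> E v w)" if "v \<in> V" for v
  proof
    assume "\<exists>!w. w \<in> f ` V \<and> E (f v) w"
    then obtain w where w: "w \<in> f ` V" "E (f v) w"
      and unique: "\<And>w'. w' \<in> f ` V \<Longrightarrow> E (f v) w' \<Longrightarrow> w' = w"
      by blast
    obtain x where x: "x \<in> V" "w = f x"
      using w(1) by auto
    show "\<exists>!w. w \<in> V \<and> E v w"
    proof (rule ex1I[of _ x])
      show "x \<in> V \<and> E v x"
        using assms(2) that w x by simp
    next
      fix y assume y: "y \<in> V \<and> E v y"
      then have "f y = f x"
        using unique[of "f y"] assms(2) that x by simp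
      then show "y = x"
        using assms(1) x y by (simp add: inj_on_eq_iff)
    qed
  next
    assume "\<exists>!w. w \<in> V \<and> E v w"
    then obtain x where x: "x \<in> V" "E v x"
      and unique: "\<And>y. y \<in> V \<Longrightarrow> E v y \<Longrightarrow> y = x"
      by blast
    show "\<exists>!w. w \<in> f ` V \<and> E (f v) w"
    proof (rule ex1I[of _ "f x"])
      show "f x \<in> f ` V \<and> E (f v) (f x)"
        using assms(2) that x by simp
    next
      fix w assume "w \<in> f ` V \<and> E (f v) w"
      then obtain y where "y \<in> V" "w = f y" "E (f v) (f y)"
        by blast
      then show "w = f x"
        using assms(2) that unique by simp
    qed
  qed
  then show ?thesis
    unfolding induces_matching_def by simp
qed

lemma card_pverts_eq_twice_card_uedges:
  assumes "\<And>a. (a, a) \<notin> parcs H" and "pverts H = \<Union> (uedges H)" and "disjoint (uedges H)"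
  shows "card (pverts H) = 2 * card (uedges H)"
proof -
  have two: "finite e \<and> card e = 2" if "e \<in> uedges H" for e
    using that assms(1) by (auto simp: uedges_def card_insert_if)
  have "card (\<Union> (uedges H)) = sum card (uedges H)"
    using assms(3) two by (intro card_Union_disjoint) auto
  also have "\<dots> = (\<Sum>e\<in>uedges H. 2)"
    using two by (intro sum.cong) auto
  finally show ?thesis
    using assms(2) by simp
qed

text \<open>
  An induced subgraph carries no information beyond its vertices.  That its edges are disjoint and
  cover it says that each vertex lies on exactly one edge, that is, has exactly one neighbour.
\<close>

lemma induced_matching_iff_vertex_set:
  assumes "pair_graph G"
  shows "induced_matching G m H \<longleftrightarrow>
    pverts H \<subseteq> pverts G \<and> parcs H = parcs G \<inter> pverts H \<times> pverts H \<and>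
    induces_matching (\<lambda>a b. (a, b) \<in> parcs G) (pverts H) \<and> card (pverts H) = 2 * m"
    (is "_ \<longleftrightarrow> ?sub \<and> ?ind \<and> ?match \<and> ?size")
proof -
  interpret pair_graph G by fact
  have sym: "(b, a) \<in> parcs G" if "(a, b) \<in> parcs G" for a b
    using that pair_sym_arcs by (auto simp: symmetric_def dest: symD)
  have loopfree: "(a, a) \<notin> parcs G" for a
    using pair_no_loops by fastforce
  have "induced_subgraph (with_proj H) (with_proj G) \<longleftrightarrow> ?sub \<and> ?ind"
    unfolding induced_subgraph_def subgraph_def compatible_def wf_digraph_def
    using arc_fst_in_verts arc_snd_in_verts by fastforce
  moreover have "pverts H = \<Union> (uedges H) \<and> disjoint (uedges H) \<and>
      finite (uedges H) \<and> card (uedges H) = m \<longleftrightarrow> ?match \<and> ?size"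
    if sub: ?sub and ind: ?ind
  proof -
    have noloop: "(a, a) \<notin> parcs H" for a
      using ind loopfree by auto
    have fin: "finite (pverts H)"
      using sub pair_finite_verts finite_subset by blast
    have edges_fin: "finite (uedges H)"
      by (rule finite_subset[of _ "Pow (pverts H)"]) (use fin ind in \<open>auto simp: uedges_def\<close>)
    have "pverts H = \<Union> (uedges H) \<and> disjoint (uedges H) \<longleftrightarrow> ?match"
    proof
      assume *: "pverts H = \<Union> (uedges H) \<and> disjoint (uedges H)"
      show ?match
        unfolding induces_matching_def
      proof (intro ballI ex_ex1I)
        fix v assume v: "v \<in> pverts H"
        show "\<exists>w. w \<in> pverts H \<and> (v, w) \<in> parcs G"
        proof -
          obtain e where "e \<in> uedges H" "v \<in> e"
            using v * by (metis UnionE)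
          then obtain a b where "(a, b) \<in> parcs H" "v = a \<or> v = b"
            by (auto simp: uedges_def)
          then show ?thesis
            using ind sym by auto
        qed
      next
        fix v w w'
        assume v: "v \<in> pverts H" and w: "w \<in> pverts H \<and> (v, w) \<in> parcs G"
          and w': "w' \<in> pverts H \<and> (v, w') \<in> parcs G"
        have "{v, w} \<in> uedges H" "{v, w'} \<in> uedges H"
          using v w w' ind by (auto simp: uedges_def)
        then have "{v, w} = {v, w'}"
          using * pairwiseD[of disjnt "uedges H" "{v, w}" "{v, w'}"] by (auto simp: disjnt_iff)
        then show "w = w'"
          by (auto simp: doubleton_eq_iff)
      qed
    next
      assume M: ?match
      have "pverts H = \<Union> (uedges H)"
      proof
        show "pverts H \<subseteq> \<Union> (uedges H)"
        proof
          fix v assume "v \<in> pverts H"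
          then obtain w where "(v, w) \<in> parcs H"
            using M ind unfolding induces_matching_def by blast
          then have "{v, w} \<in> uedges H"
            by (auto simp: uedges_def)
          then show "v \<in> \<Union> (uedges H)"
            by blast
        qed
      qed (use ind in \<open>auto simp: uedges_def\<close>)
      moreover have "disjoint (uedges H)"
      proof (rule pairwiseI, rule ccontr)
        fix e e' assume e: "e \<in> uedges H" "e' \<in> uedges H" "e \<noteq> e'" "\<not> disjnt e e'"
        then obtain v where v: "v \<in> e" "v \<in> e'"
          by (auto simp: disjnt_iff)
        have at: "\<exists>w. f = {v, w} \<and> v \<in> pverts H \<and> w \<in> pverts H \<and> (v, w) \<in> parcs G"
          if f: "f \<in> uedges H" "v \<in> f" for f
        proof -
          obtain a b where ab: "f = {a, b}" "(a, b) \<in> parcs H"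
            using f(1) by (auto simp: uedges_def)
          then have "(b, a) \<in> parcs G" "(a, b) \<in> parcs G" "a \<in> pverts H" "b \<in> pverts H"
            using ind sym by auto
          moreover have "v = a \<or> v = b"
            using f(2) ab by simp
          ultimately show ?thesis
            using ab(1) by (metis insert_commute)
        qed
        obtain w w' where "e = {v, w}" "w \<in> pverts H" "(v, w) \<in> parcs G"
          "e' = {v, w'}" "w' \<in> pverts H" "(v, w') \<in> parcs G" "v \<in> pverts H"
          using at[OF e(1) v(1)] at[OF e(2) v(2)] by auto
        moreover from this have "w = w'"
          using M unfolding induces_matching_def by blast
        ultimately show False
          using e(3) by simp
      qed
      ultimately show "pverts H = \<Union> (uedges H) \<and> disjoint (uedges H)" ..
    qed
    then show ?thesis
      using card_pverts_eq_twice_card_uedges[of H] noloop edges_fin by auto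
  qed
  ultimately show ?thesis
    unfolding induced_matching_def by blast
qed

lemma card_induced_matchings:
  assumes "pair_graph G"
  shows "card {H. induced_matching G m H} =
    card {V. V \<subseteq> pverts G \<and> induces_matching (\<lambda>a b. (a, b) \<in> parcs G) V \<and> card V = 2 * m}"
    (is "card ?A = card ?B")
proof (rule bij_betw_same_card)
  show "bij_betw pverts ?A ?B"
    by (rule bij_betw_byWitness[where f' = "\<lambda>V. \<lparr>pverts = V, parcs = parcs G \<inter> V \<times> V\<rparr>"])
      (auto simp: induced_matching_iff_vertex_set[OF assms])
qed


section \<open>Sets with distinct residues\<close>

lemma distinct_residues_card_le:
  fixes S :: "int set"
  assumes "0 < t" and "inj_on (\<lambda>x. x mod t) S"
  shows "int (card S) \<le> t"
proof -
  have "card ((\<lambda>x. x mod t) ` S) \<le> card {0..<t}"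
    using assms by (intro card_mono) auto
  then show ?thesis
    using assms by (simp add: card_image)
qed

text \<open>
  Every residue is hit, so the residues can be followed upwards one at a time from the minimum.  For
  fewer than \<open>t\<close> steps, the element with the next residue cannot lie below its predecessor, because
  it would then be below the minimum; hence \<open>step\<close> applies and it is the very next integer.
\<close>

lemma residue_system_is_interval:
  fixes S :: "int set"
  assumes t: "0 < t" and inj: "inj_on (\<lambda>x. x mod t) S" and card: "int (card S) = t"
    and step: "\<And>x y. x \<in> S \<Longrightarrow> y \<in> S \<Longrightarrow> x < y \<Longrightarrow> t dvd y - x - 1 \<Longrightarrow> y = x + 1"
  shows "S = {Min S..<Min S + t}"
proof -
  have fin: "finite S" and ne: "S \<noteq> {}"
    using t card by (auto intro: card_ge_0_finite)
  have "(\<lambda>x. x mod t) ` S = {0..<t}"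
    using t card inj by (intro card_subset_eq) (auto simp: card_image)
  then have hit: "\<exists>x\<in>S. t dvd x - r" for r
    using t by (metis (no_types, lifting) atLeastLessThan_iff image_iff mod_eq_dvd_iff
        pos_mod_bound pos_mod_sign)
  have "Min S + int s \<in> S" if "int s < t" for s
    using that
  proof (induction s)
    case 0
    then show ?case using fin ne by simp
  next
    case (Suc s)
    obtain x where x: "x \<in> S" "t dvd x - (Min S + int s + 1)"
      using hit by blast
    have "Min S \<le> x"
      using fin x by simp
    then obtain c where c: "x = Min S + int s + 1 + t * c"
      using x(2) by (metis add.commute diff_add_cancel dvdE)
    have "0 \<le> c"
    proof (rule ccontr)
      assume "\<not> 0 \<le> c"
      then have "t * c \<le> t * (- 1)"
        using t by (intro mult_left_mono) auto
      then show False
        using c \<open>Min S \<le> x\<close> Suc.prems by simp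
    qed
    then have "0 \<le> t * c"
      using t by simp
    then have "x = Min S + int s + 1"
      using step[of "Min S + int s" x] Suc c x(1) by simp
    then show ?case
      using x(1) by (simp add: algebra_simps)
  qed
  then have "x \<in> S" if "x \<in> {Min S..<Min S + t}" for x
    using that by (metis add.commute atLeastLessThan_iff diff_add_cancel diff_less_eq
        diff_ge_0_iff_ge nat_0_le)
  then have "{Min S..<Min S + t} \<subseteq> S"
    by blast
  then show ?thesis
    using fin card t by (metis card_atLeastLessThan_int card_subset_eq add_diff_cancel_left' nat_int)
qed

section \<open>Diagonals of a polygon\<close>

locale polygon_diagonals =
  fixes t q n :: int
  assumes t_pos: "1 \<le> t" and q_ge: "3 \<le> q" and n_eq: "n = t * q + 2"
begin

text \<open>The argument is a number of steps around the polygon.\<close>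

definition diag :: "int \<Rightarrow> bool" where
  "diag m \<longleftrightarrow> t dvd m - 1 \<and> 1 < m \<and> m < n - 1"

definition adj :: "int \<Rightarrow> int \<Rightarrow> bool" where
  "adj x y \<longleftrightarrow> diag ((y - x) mod n)"

definition rot :: "int \<Rightarrow> int \<Rightarrow> int" where
  "rot c x = (x + c) mod n"

lemma n_ge: "3 * t + 2 \<le> n"
  using t_pos q_ge mult_left_mono[of 3 q t] by (simp add: n_eq)

lemma n_pos: "0 < n"
  using n_ge t_pos by simp

text \<open>The special form of \<open>n\<close> enters here: it makes adjacency independent of the direction.\<close>

lemma diag_complement: "diag (n - m) \<longleftrightarrow> diag m"
proof -
  have "n - m - 1 = t * q - (m - 1)"
    by (simp add: n_eq)
  then have "t dvd n - m - 1 \<longleftrightarrow> t dvd m - 1"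
    by (metis dvd_diff_right_iff dvd_triv_left)
  then show ?thesis
    by (auto simp: diag_def)
qed

lemma adj_linear:
  assumes "0 \<le> x" "x < y" "y < n"
  shows "adj x y \<longleftrightarrow> diag (y - x)" and "adj y x \<longleftrightarrow> diag (y - x)"
proof -
  show "adj x y \<longleftrightarrow> diag (y - x)"
    using assms by (simp add: adj_def)
  have "(x - y) mod n = n - (y - x)"
    using assms mod_add_self2[of "x - y" n] mod_pos_pos_trivial[of "x - y + n" n] by simp
  then show "adj y x \<longleftrightarrow> diag (y - x)"
    by (simp add: adj_def diag_complement)
qed

lemma not_adj_self: "\<not> adj x x"
  by (simp add: adj_def diag_def)

lemma adj_rot: "adj (rot c x) (rot c y) \<longleftrightarrow> adj x y"
proof -
  have "((y + c) mod n - (x + c) mod n) mod n = (y - x) mod n"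
    by (simp add: mod_diff_eq)
  then show ?thesis
    by (simp add: adj_def rot_def)
qed

lemma rot_rot: "rot c (rot d x) = rot (c + d) x"
  using mod_add_left_eq[of "x + d" n c] by (simp add: rot_def algebra_simps)

lemma rot_range: "rot c ` V \<subseteq> {0..<n}"
  using n_pos by (auto simp: rot_def)

lemma inj_on_rot: "V \<subseteq> {0..<n} \<Longrightarrow> inj_on (rot c) V"
proof (rule inj_onI)
  fix x y assume "V \<subseteq> {0..<n}" "x \<in> V" "y \<in> V" "rot c x = rot c y"
  then have "rot (- c) (rot c x) = rot (- c) (rot c y)" "0 \<le> x" "x < n" "0 \<le> y" "y < n"
    by auto
  then show "x = y"
    by (simp only: rot_rot) (simp add: rot_def)
qed

lemma rot_0: "V \<subseteq> {0..<n} \<Longrightarrow> rot 0 ` V = V"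
proof -
  assume "V \<subseteq> {0..<n}"
  then have "rot 0 ` V = id ` V"
    by (intro image_cong) (auto simp: rot_def)
  then show ?thesis
    by simp
qed

lemma rot_image_rot: "rot c ` rot d ` V = rot (c + d) ` V"
  by (simp add: image_image rot_rot)

lemma induces_matching_rot:
  "V \<subseteq> {0..<n} \<Longrightarrow> induces_matching adj (rot c ` V) \<longleftrightarrow> induces_matching adj V"
  by (intro induces_matching_image) (auto simp: adj_rot inj_on_rot)

lemma card_rot: "V \<subseteq> {0..<n} \<Longrightarrow> card (rot c ` V) = card V"
  by (intro card_image inj_on_rot)

text \<open>
  A matching away from \<open>0\<close> is split into its lower endpoints \<open>L\<close> and the partners \<open>p ` L\<close> above them.
  Excluding \<open>0\<close> rules out the difference \<open>n - 1\<close>, the one side of the polygon that would escape the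
  argument for distinct residues.
\<close>

lemma matching_endpoints:
  assumes V: "V \<subseteq> {1..<n}" and M: "induces_matching adj V"
  obtains L p where "V = L \<union> p ` L" "L \<inter> p ` L = {}" "inj_on p L"
    and "\<And>a. a \<in> L \<Longrightarrow> diag (p a - a)"
    and "inj_on (\<lambda>x. x mod t) L"
    and "\<And>x y. x \<in> V \<Longrightarrow> y \<in> V \<Longrightarrow> x < y \<Longrightarrow> diag (y - x) \<Longrightarrow> x \<in> L \<and> y = p x"
proof -
  define p where "p v = (THE w. w \<in> V \<and> adj v w)" for v
  define L where "L = {v \<in> V. v < p v}"
  have p: "p v \<in> V" "adj v (p v)" if "v \<in> V" for v
    using theI'[of "\<lambda>w. w \<in> V \<and> adj v w"] M that by (auto simp: induces_matching_def p_def)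
  have p_eq: "w = p v" if "v \<in> V" "w \<in> V" "adj v w" for v w
    using M that p[of v] by (auto simp: induces_matching_def)
  have sym: "adj y x" if "adj x y" "x \<in> V" "y \<in> V" for x y
    using that V adj_linear[of x y] adj_linear[of y x] by (cases x y rule: linorder_cases) force+
  have pp: "p (p v) = v" if "v \<in> V" for v
    using p_eq p sym that by metis
  have ne: "p v \<noteq> v" if "v \<in> V" for v
    using p(2)[OF that] not_adj_self by metis
  have lin: "adj x y \<longleftrightarrow> diag (y - x)" if "x \<in> V" "y \<in> V" "x < y" for x y
    using that V by (intro adj_linear) auto
  have inV: "V = L \<union> p ` L"
  proof
    show "V \<subseteq> L \<union> p ` L"
    proof
      fix v assume v: "v \<in> V"
      show "v \<in> L \<union> p ` L"
      proof (cases "v < p v")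
        case True
        then show ?thesis using v by (simp add: L_def)
      next
        case False
        then have "p v < v" using ne[OF v] by simp
        then have "p v \<in> L" using p(1)[OF v] pp[OF v] by (simp add: L_def)
        then show ?thesis using pp[OF v] by (metis UnI2 image_eqI)
      qed
    qed
  qed (use p in \<open>auto simp: L_def\<close>)
  have disj: "L \<inter> p ` L = {}"
    using pp by (auto simp: L_def)
  have inj: "inj_on p L"
    using pp by (intro inj_on_inverseI[of _ p]) (auto simp: L_def)
  have dia: "diag (p a - a)" if "a \<in> L" for a
    using that lin p by (auto simp: L_def)
  have unique: "x \<in> L \<and> y = p x" if "x \<in> V" "y \<in> V" "x < y" "diag (y - x)" for x y
    using that lin p_eq by (auto simp: L_def)
  have "a = b" if "a \<in> L" "b \<in> L" "a mod t = b mod t" "a \<le> b" for a b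
  proof (rule ccontr)
    assume "a \<noteq> b"
    then have "a < b" using that by simp
    have d: "t dvd p b - b - 1" "1 < p b - b"
      using dia[OF that(2)] by (auto simp: diag_def)
    have "t dvd b - a"
      using that(3) by (metis mod_eq_dvd_iff)
    then have "t dvd p b - a - 1"
      using dvd_add[OF d(1), of "b - a"] by (simp add: algebra_simps)
    moreover have in_V: "a \<in> V" "p b \<in> V"
      using that p by (auto simp: L_def)
    moreover have "1 \<le> a" "p b < n"
      using subsetD[OF V in_V(1)] subsetD[OF V in_V(2)] by auto
    ultimately have "diag (p b - a)"
      using d \<open>a < b\<close> unfolding diag_def by linarith
    then have "p b = p a"
      using unique in_V d \<open>a < b\<close> by force
    then show False
      using inj that \<open>a \<noteq> b\<close> by (auto dest: inj_onD)
  qed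
  then have "inj_on (\<lambda>x. x mod t) L"
    by (intro inj_onI) (metis linear)
  then show thesis
    using that inV disj inj dia unique by blast
qed

text \<open>
  Adjacent elements of \<open>V\<close> are a lower and an upper endpoint, so neither of these two classes contains
  adjacent elements and \<open>residue_system_is_interval\<close> applies to both.
\<close>

lemma full_matching_linear:
  assumes V: "V \<subseteq> {1..<n}" and M: "induces_matching adj V" and card: "int (card V) = 2 * t"
  obtains a b where "V = {a..<a + t} \<union> {b..<b + t}" "1 \<le> a" "a + t + 1 \<le> b" "b + t \<le> n"
proof -
  obtain L p where LV: "V = L \<union> p ` L" and disj: "L \<inter> p ` L = {}" and inj: "inj_on p L"
    and dia: "\<And>a. a \<in> L \<Longrightarrow> diag (p a - a)"
    and res: "inj_on (\<lambda>x. x mod t) L"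
    and unique: "\<And>x y. x \<in> V \<Longrightarrow> y \<in> V \<Longrightarrow> x < y \<Longrightarrow> diag (y - x) \<Longrightarrow> x \<in> L \<and> y = p x"
    by (rule matching_endpoints[OF V M]) (rule that, assumption+)
  have finV: "finite V"
    using V finite_subset by blast
  then have fin: "finite L"
    using LV by simp
  have cU: "card (p ` L) = card L"
    using inj by (simp add: card_image)
  have cL: "int (card L) = t"
    using card cU disj fin by (simp add: LV card_Un_disjoint)
  have resp: "(p x) mod t = (x + 1) mod t" if "x \<in> L" for x
    using dia[OF that] by (simp add: diag_def mod_eq_dvd_iff algebra_simps)
  have resU: "inj_on (\<lambda>x. x mod t) (p ` L)"
  proof (rule inj_onI, clarify)
    fix x y assume "x \<in> L" "y \<in> L" "p x mod t = p y mod t"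
    then have "(x + 1) mod t = (y + 1) mod t"
      using resp by simp
    then have "x mod t = y mod t"
      by (simp add: mod_eq_dvd_iff)
    then show "p x = p y"
      using res \<open>x \<in> L\<close> \<open>y \<in> L\<close> by (auto dest: inj_onD)
  qed
  have step: "y = x + 1"
    if "x \<in> V" "y \<in> V" "x < y" "t dvd y - x - 1" "\<not> (x \<in> L \<and> y \<in> p ` L)" for x y
  proof (rule ccontr)
    assume "y \<noteq> x + 1"
    moreover have "1 \<le> x" "y < n"
      using that V by auto
    ultimately have "diag (y - x)"
      using that by (simp add: diag_def)
    then show False
      using unique that by blast
  qed
  define a where "a = Min L"
  define b where "b = Min (p ` L)"
  have L: "L = {a..<a + t}"
    unfolding a_def using t_pos res cL
  proof (intro residue_system_is_interval)
    fix x y assume "x \<in> L" "y \<in> L" "x < y" "t dvd y - x - 1"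
    moreover from this have "x \<in> V" "y \<in> V" "\<not> (x \<in> L \<and> y \<in> p ` L)"
      using LV disj by auto
    ultimately show "y = x + 1"
      by (intro step)
  qed auto
  have U: "p ` L = {b..<b + t}"
    unfolding b_def using t_pos resU cL cU
  proof (intro residue_system_is_interval)
    fix x y assume "x \<in> p ` L" "y \<in> p ` L" "x < y" "t dvd y - x - 1"
    moreover from this have "x \<in> V" "y \<in> V" "\<not> (x \<in> L \<and> y \<in> p ` L)"
      using LV disj by auto
    ultimately show "y = x + 1"
      by (intro step)
  qed auto
  have "b \<in> p ` L"
    using U t_pos by simp
  then obtain x where "x \<in> L" "b = p x"
    by blast
  then have "a < b"
    using dia[of x] L by (auto simp: diag_def)
  moreover have "b \<notin> {a..<a + t}"
    using disj \<open>b \<in> p ` L\<close> unfolding L[symmetric] by blast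
  ultimately have "a + t \<le> b"
    by simp
  \<comment> \<open>If the runs touched, the partner of the last lower endpoint would be congruent to \<open>b\<close>, hence
    equal to \<open>b\<close>, which is the other end of a side.\<close>
  moreover have "b \<noteq> a + t"
  proof
    assume eq: "b = a + t"
    define z where "z = a + t - 1"
    have z: "z \<in> L" using L t_pos by (simp add: z_def)
    then have "p z \<in> {b..<b + t}" using U by blast
    moreover have "t dvd p z - b" "1 < p z - z"
      using dia[OF z] by (auto simp: diag_def z_def eq algebra_simps)
    ultimately show False
      using zdvd_imp_le[of t "p z - b"] by (auto simp: z_def eq)
  qed
  moreover have "a \<in> V" "b + t - 1 \<in> V"
    using LV L U t_pos by auto
  ultimately show thesis
    using that[of a b] LV L U V by force
qed

text \<open>The normal form up to rotation of the full matchings: one run starts at \<open>0\<close>, the other at \<open>d\<close>.\<close>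

definition blocks :: "int \<Rightarrow> int set" where
  "blocks d = {0..<t} \<union> {d..<d + t}"

lemma blocks_range: "t + 1 \<le> d \<Longrightarrow> d \<le> n - t - 1 \<Longrightarrow> blocks d \<subseteq> {0..<n}"
  using t_pos by (auto simp: blocks_def)

lemma card_blocks: "t + 1 \<le> d \<Longrightarrow> int (card (blocks d)) = 2 * t"
  using t_pos by (simp add: blocks_def card_Un_disjoint ivl_disj_int)

text \<open>
  Differences inside a run are too small to be diagonals, and differences between the runs lie
  strictly between \<open>1\<close> and \<open>n - 1\<close>.  So the neighbours of a vertex are the elements of the other run in
  one residue class, of which a run of length \<open>t\<close> has exactly one.
\<close>

lemma induces_matching_blocks:
  assumes d: "t + 1 \<le> d" "d \<le> n - t - 1"
  shows "induces_matching adj (blocks d)"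
proof -
  have small: "\<not> diag m" if "0 < m" "m < t" for m
    using that zdvd_imp_le[of t "m - 1"] by (auto simp: diag_def)
  have same: "\<not> adj x y" if "x \<in> {e..<e + t}" "y \<in> {e..<e + t}" "e = 0 \<or> e = d" for x y e
    using that d small[of "y - x"] small[of "x - y"] adj_linear[of x y] adj_linear[of y x]
      not_adj_self[of x] t_pos
    by (cases x y rule: linorder_cases) auto
  have cross: "(adj x y \<longleftrightarrow> t dvd y - x - 1) \<and> (adj y x \<longleftrightarrow> t dvd y - x - 1)"
    if "x \<in> {0..<t}" "y \<in> {d..<d + t}" for x y
    using that d adj_linear[of x y] by (auto simp: diag_def)
  have solve: "\<exists>!y. y \<in> {e..<e + t} \<and> t dvd y - r" for e r
  proof (rule ex1I[of _ "e + (r - e) mod t"])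
    have "e + (r - e) mod t - r = - (r - e - (r - e) mod t)"
      by simp
    then have "t dvd e + (r - e) mod t - r"
      by (metis dvd_minus_iff dvd_minus_mod)
    then show "e + (r - e) mod t \<in> {e..<e + t} \<and> t dvd e + (r - e) mod t - r"
      using t_pos by simp
  next
    fix y assume y: "y \<in> {e..<e + t} \<and> t dvd y - r"
    have "(y - e) mod t = (r - e) mod t"
      unfolding mod_eq_dvd_iff using y by simp
    moreover have "(y - e) mod t = y - e"
      using y by (intro mod_pos_pos_trivial) auto
    ultimately show "y = e + (r - e) mod t"
      by simp
  qed
  show ?thesis
    unfolding induces_matching_def
  proof
    fix v assume v: "v \<in> blocks d"
    show "\<exists>!w. w \<in> blocks d \<and> adj v w"
    proof (cases "v \<in> {0..<t}")
      case True
      then have "w \<in> blocks d \<and> adj v w \<longleftrightarrow> w \<in> {d..<d + t} \<and> t dvd w - (v + 1)" for w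
        using same[of v 0 w] cross[of v w] by (auto simp: blocks_def algebra_simps)
      then show ?thesis using solve by simp
    next
      case False
      then have vd: "v \<in> {d..<d + t}" using v unfolding blocks_def by blast
      have "t dvd v - w - 1 \<longleftrightarrow> t dvd w - (v - 1)" for w
      proof -
        have "w - (v - 1) = - (v - w - 1)"
          by simp
        then show ?thesis
          by (simp only: dvd_minus_iff)
      qed
      then have "w \<in> blocks d \<and> adj v w \<longleftrightarrow> w \<in> {0..<0 + t} \<and> t dvd w - (v - 1)" for w
        using vd same[of v d w] cross[of w v] by (auto simp: blocks_def)
      then show ?thesis using solve[of 0 "v - 1"] by simp
    qed
  qed
qed

text \<open>
  The inequality \<open>q \<ge> 3\<close>, that is \<open>k \<ge> 4\<close>, provides the second neighbour of \<open>0\<close>.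
\<close>

lemma whole_graph_no_matching: "\<not> induces_matching adj {0..<n}"
proof
  assume M: "induces_matching adj {0..<n}"
  have "adj 0 (1 + t)" "adj 0 (1 + 2 * t)" "1 + t \<in> {0..<n}" "1 + 2 * t \<in> {0..<n}" "0 \<in> {0..<n}"
    using n_ge t_pos by (simp_all add: adj_linear diag_def)
  then have "1 + t = 1 + 2 * t"
    using M unfolding induces_matching_def by blast
  then show False using t_pos by simp
qed

lemma rotate_off_zero:
  assumes V: "V \<subseteq> {0..<n}" and M: "induces_matching adj V"
  obtains c where "rot c ` V \<subseteq> {1..<n}" "rot (- c) ` rot c ` V = V"
proof -
  have "V \<noteq> {0..<n}"
    using M whole_graph_no_matching by auto
  then obtain v where v: "v \<in> {0..<n}" "v \<notin> V"
    using V by blast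
  have "0 \<notin> rot (- v) ` V"
  proof
    assume "0 \<in> rot (- v) ` V"
    then obtain x where x: "x \<in> V" "rot (- v) x = 0" by auto
    then have "rot v (rot (- v) x) = rot v 0" by simp
    then have "x = v" using x v V unfolding rot_rot by (force simp: rot_def)
    then show False using x v by simp
  qed
  then have "rot (- v) ` V \<subseteq> {1..<n}"
    using rot_range[of "- v" V] by (force simp: image_subset_iff)
  then show thesis
    using that[of "- v"] V by (simp add: rot_image_rot rot_0)
qed

lemma card_matching_le:
  assumes V: "V \<subseteq> {0..<n}" and M: "induces_matching adj V"
  shows "int (card V) \<le> 2 * t"
proof -
  obtain c where c: "rot c ` V \<subseteq> {1..<n}"
    using rotate_off_zero[OF assms] by blast
  have M': "induces_matching adj (rot c ` V)"
    using M V by (simp add: induces_matching_rot)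
  obtain L p where L: "rot c ` V = L \<union> p ` L" and inj: "inj_on p L"
    and res: "inj_on (\<lambda>x. x mod t) L"
    by (rule matching_endpoints[OF c M']) (rule that, assumption+)
  have "card V = card (rot c ` V)"
    using V by (simp add: card_rot)
  also have "\<dots> \<le> card L + card (p ` L)"
    unfolding L by (rule card_Un_le)
  also have "\<dots> = 2 * card L"
    using inj by (simp add: card_image)
  finally show ?thesis
    using distinct_residues_card_le[OF _ res] t_pos by linarith
qed

lemma full_matching_iff:
  "V \<subseteq> {0..<n} \<and> induces_matching adj V \<and> int (card V) = 2 * t \<longleftrightarrow>
    (\<exists>i. \<exists>d\<in>{t + 1..n - t - 1}. V = rot i ` blocks d)"
  (is "?full \<longleftrightarrow> _")
proof
  assume F: ?full
  then obtain c where c: "rot c ` V \<subseteq> {1..<n}" "rot (- c) ` rot c ` V = V"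
    using rotate_off_zero by blast
  have "induces_matching adj (rot c ` V)" "int (card (rot c ` V)) = 2 * t"
    using F by (auto simp: induces_matching_rot card_rot)
  then obtain a b where ab: "rot c ` V = {a..<a + t} \<union> {b..<b + t}"
    "1 \<le> a" "a + t + 1 \<le> b" "b + t \<le> n"
    using full_matching_linear[OF c(1)] by metis
  have "{a..<a + t} \<union> {b..<b + t} = (\<lambda>x. x + a) ` blocks (b - a)"
    by (simp add: blocks_def image_Un add.commute)
  also have "\<dots> = rot a ` blocks (b - a)"
    using ab t_pos by (intro image_cong) (auto simp: rot_def blocks_def)
  finally have "V = rot (a - c) ` blocks (b - a)"
    using c(2) ab(1) by (simp add: rot_image_rot)
  then show "\<exists>i. \<exists>d\<in>{t + 1..n - t - 1}. V = rot i ` blocks d"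
    using ab by force
next
  assume "\<exists>i. \<exists>d\<in>{t + 1..n - t - 1}. V = rot i ` blocks d"
  then obtain i d where d: "t + 1 \<le> d" "d \<le> n - t - 1" and V: "V = rot i ` blocks d"
    by auto
  show ?full
    using blocks_range[OF d] rot_range[of i "blocks d"] induces_matching_blocks[OF d]
    unfolding V by (simp add: induces_matching_rot card_rot card_blocks d)
qed

lemma mem_rot_blocks:
  assumes "0 \<le> x" "x < n"
  shows "x \<in> rot i ` blocks d \<longleftrightarrow> (x - i) mod n < t \<or> (x - i - d) mod n < t"
proof -
  have run: "x \<in> rot j ` {0..<t} \<longleftrightarrow> (x - j) mod n < t" for j
  proof
    assume "x \<in> rot j ` {0..<t}"
    then obtain s where "0 \<le> s" "s < t" "x = (s + j) mod n" by (auto simp: rot_def)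
    then show "(x - j) mod n < t" using n_ge t_pos by (simp add: mod_simps)
  next
    assume "(x - j) mod n < t"
    moreover have "x = rot j ((x - j) mod n)"
      using assms by (simp add: rot_def mod_simps)
    ultimately show "x \<in> rot j ` {0..<t}"
      using n_pos by (intro image_eqI[of x "rot j" "(x - j) mod n"]) auto
  qed
  have "{d..<d + t} = (\<lambda>s. s + d) ` {0..<t}"
    by (simp add: add.commute)
  then have "rot i ` {d..<d + t} = rot (i + d) ` {0..<t}"
    by (simp only: image_image) (simp add: rot_def algebra_simps)
  then show ?thesis
    using run[of i] run[of "i + d"] by (simp add: blocks_def image_Un diff_diff_eq)
qed

text \<open>Either run may be called the first one; each matching has two descriptions.\<close>

lemma rot_blocks_swap: "rot (i + d - n) ` blocks (n - d) = rot i ` blocks d"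
proof -
  have "x \<in> rot (i + d - n) ` blocks (n - d) \<longleftrightarrow> x \<in> rot i ` blocks d" if "0 \<le> x" "x < n" for x
  proof -
    have "(x - (i + d - n)) mod n = (x - i - d) mod n"
      using mod_add_self2[of "x - i - d" n] by (simp add: algebra_simps)
    moreover have "x - (i + d - n) - (n - d) = x - i" by simp
    ultimately show ?thesis using that by (auto simp: mem_rot_blocks)
  qed
  then show ?thesis
    using rot_range by (meson atLeastLessThan_iff subset_antisym subset_iff)
qed

text \<open>
  The first vertices of the runs are those whose predecessor is missing.  They recover \<open>i\<close> and \<open>d\<close> from
  the set once \<open>i + d < n\<close> decides which run is the first.
\<close>

lemma rot_blocks_starts:
  assumes "0 \<le> i" "i + d < n" "t + 1 \<le> d" "d \<le> n - t - 1"
  shows "{x \<in> rot i ` blocks d. (x - 1) mod n \<notin> rot i ` blocks d} = {i, i + d}"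
proof -
  have step: "(y - 1) mod n < t \<longleftrightarrow> y mod n \<in> {1..t}" for y
  proof (cases "y mod n = 0")
    case True
    have "(y - 1) mod n = (y mod n - 1) mod n" by (simp add: mod_simps)
    also have "\<dots> = n - 1" using True n_ge t_pos by (simp add: zmod_minus1)
    finally show ?thesis using True n_ge t_pos by simp
  next
    case False
    have "(y - 1) mod n = (y mod n - 1) mod n" by (simp add: mod_simps)
    also have "\<dots> = y mod n - 1"
      using False n_pos pos_mod_bound[of n y] pos_mod_sign[of n y]
      by (intro mod_pos_pos_trivial) linarith+
    finally show ?thesis using False pos_mod_sign[OF n_pos, of y] by (simp; linarith)
  qed
  have iff: "x \<in> rot i ` blocks d \<and> (x - 1) mod n \<notin> rot i ` blocks d \<longleftrightarrow> x = i \<or> x = i + d"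
    if x: "0 \<le> x" "x < n" for x
  proof -
    have "(x - 1) mod n \<in> rot i ` blocks d \<longleftrightarrow>
        ((x - 1) mod n - i) mod n < t \<or> ((x - 1) mod n - i - d) mod n < t"
      using n_pos by (intro mem_rot_blocks) auto
    also have "((x - 1) mod n - i) mod n = (x - i - 1) mod n"
      by (simp add: mod_simps algebra_simps)
    also have "((x - 1) mod n - i - d) mod n = (x - i - d - 1) mod n"
      by (metis (no_types, opaque_lifting) diff_diff_eq add.commute mod_diff_left_eq)
    finally have pred: "(x - 1) mod n \<in> rot i ` blocks d \<longleftrightarrow>
        (x - i) mod n \<in> {1..t} \<or> (x - i - d) mod n \<in> {1..t}"
      by (simp only: step)
    have red: "y mod n = (if 0 \<le> y then y else y + n)" if "- n \<le> y" "y < n" for y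
      using that mod_pos_pos_trivial[of "y + n" n] by auto
    show ?thesis
      using x assms t_pos unfolding pred mem_rot_blocks[OF x]
      by (auto simp: red)
  qed
  show ?thesis
  proof (rule set_eqI)
    fix x
    show "x \<in> {x \<in> rot i ` blocks d. (x - 1) mod n \<notin> rot i ` blocks d} \<longleftrightarrow> x \<in> {i, i + d}"
    proof (cases "0 \<le> x \<and> x < n")
      case True
      then show ?thesis using iff[of x] by blast
    next
      case False
      then have "x \<notin> rot i ` blocks d" "x \<noteq> i" "x \<noteq> i + d"
        using rot_range[of i "blocks d"] assms t_pos by auto
      then show ?thesis by blast
    qed
  qed
qed

text \<open>
  Each full matching is described by exactly one pair \<open>(d, i)\<close> with \<open>i + d < n\<close>.  The sum over \<open>d\<close> of the
  \<open>n - d\<close> choices for \<open>i\<close> is evaluated through the symmetry \<open>d \<mapsto> n - d\<close> of the range of \<open>d\<close>.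
\<close>

lemma card_full_matchings:
  "2 * int (card {V. V \<subseteq> {0..<n} \<and> induces_matching adj V \<and> int (card V) = 2 * t}) =
    n * (n - 2 * t - 1)"
proof -
  define D where "D = {t + 1..n - t - 1}"
  define Y where "Y = (SIGMA d:D. {0..<n - d})"
  have "{V. V \<subseteq> {0..<n} \<and> induces_matching adj V \<and> int (card V) = 2 * t} =
      (\<lambda>(d, i). rot i ` blocks d) ` Y" (is "?F = _")
  proof -
    have "rot i ` blocks d \<in> (\<lambda>(d, i). rot i ` blocks d) ` Y" if d: "d \<in> D" for i d
    proof -
      define j where "j = i mod n"
      have j: "0 \<le> j" "j < n" using n_pos by (auto simp: j_def)
      have "rot i ` blocks d = rot j ` blocks d"
        by (simp add: rot_def j_def mod_simps)
      moreover have "rot j ` blocks d \<in> (\<lambda>(d, i). rot i ` blocks d) ` Y"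
      proof (cases "j + d < n")
        case True
        then have "(d, j) \<in> Y" using d j by (simp add: Y_def)
        then show ?thesis by (rule rev_image_eqI) simp
      next
        case False
        then have "(n - d, j + d - n) \<in> Y" using d j by (simp add: Y_def D_def)
        then have "rot (j + d - n) ` blocks (n - d) \<in> (\<lambda>(d, i). rot i ` blocks d) ` Y"
          by (rule rev_image_eqI) simp
        then show ?thesis by (simp only: rot_blocks_swap)
      qed
      ultimately show ?thesis by simp
    qed
    then show ?thesis
      unfolding full_matching_iff by (auto simp: Y_def D_def)
  qed
  moreover have "inj_on (\<lambda>(d, i). rot i ` blocks d) Y"
  proof (rule inj_onI, clarify)
    fix d i d' i'
    assume Y: "(d, i) \<in> Y" "(d', i') \<in> Y" and eq: "rot i ` blocks d = rot i' ` blocks d'"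
    have "{i, i + d} = {i', i' + d'}"
      using rot_blocks_starts[of i d] rot_blocks_starts[of i' d'] Y eq
      by (simp add: Y_def D_def)
    moreover have "0 < d" "0 < d'"
      using Y t_pos by (auto simp: Y_def D_def)
    ultimately show "d = d' \<and> i = i'"
      by (auto simp: doubleton_eq_iff)
  qed
  ultimately have "card ?F = card Y"
    by (simp add: card_image)
  also have "int (card Y) = (\<Sum>d\<in>D. n - d)"
    using t_pos by (simp add: Y_def D_def card_SigmaI)
  finally have "int (card ?F) = (\<Sum>d\<in>D. n - d)" .
  moreover have "(\<Sum>d\<in>D. n - d) = (\<Sum>d\<in>D. d)"
    by (rule sum.reindex_bij_witness[of _ "\<lambda>d. n - d" "\<lambda>d. n - d"]) (auto simp: D_def)
  ultimately have "2 * int (card ?F) = (\<Sum>d\<in>D. n - d) + (\<Sum>d\<in>D. d)"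
    by simp
  also have "\<dots> = (\<Sum>d\<in>D. n)"
    by (simp flip: sum.distrib)
  also have "\<dots> = n * (n - 2 * t - 1)"
    using n_ge t_pos by (simp add: D_def)
  finally show ?thesis .
qed

end

section \<open>The induced matchings of the graph\<close>

lemma GA'_arcs_iff:
  assumes "t \<ge> 1" "k \<ge> 4"
  shows "(a, b) \<in> parcs (GA' t k) \<longleftrightarrow> a \<in> pverts (GA' t k) \<and> b \<in> pverts (GA' t k) \<and>
    polygon_diagonals.adj (int t) (int (t * (k - 1) + 2)) a b"
proof -
  define n where "n = int (t * (k - 1) + 2)"
  interpret polygon_diagonals "int t" "int (k - 1)" n
    using assms by unfold_locales (auto simp: n_def)
  have "(\<exists>j\<in>{1..k - 2}. [b - a = 1 + int j * int t] (mod n)) \<longleftrightarrow> diag ((b - a) mod n)"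
  proof -
    have top: "1 + int j * int t < n - 1 \<longleftrightarrow> j \<le> k - 2" for j
    proof -
      have "1 + int j * int t < n - 1 \<longleftrightarrow> j * t < (k - 1) * t"
        unfolding n_def by (simp add: mult.commute flip: of_nat_mult)
      then show ?thesis
        using assms by auto
    qed
    have "[b - a = 1 + int j * int t] (mod n) \<longleftrightarrow> (b - a) mod n = 1 + int j * int t" if "j \<in> {1..k - 2}" for j
      using that top[of j] by (simp add: cong_def add_nonneg_nonneg)
    then have "(\<exists>j\<in>{1..k - 2}. [b - a = 1 + int j * int t] (mod n)) \<longleftrightarrow>
        (\<exists>j\<in>{1..k - 2}. (b - a) mod n = 1 + int j * int t)"
      by auto
    also have "\<dots> \<longleftrightarrow> diag ((b - a) mod n)"
    proof
      assume "\<exists>j\<in>{1..k - 2}. (b - a) mod n = 1 + int j * int t"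
      then show "diag ((b - a) mod n)"
        using top assms by (auto simp: diag_def)
    next
      assume d: "diag ((b - a) mod n)"
      then obtain c where c: "(b - a) mod n = 1 + c * int t"
        by (metis diag_def diff_add_cancel dvdE mult.commute add.commute)
      then have "0 < c * int t" using d by (simp add: diag_def)
      then have "0 < c" by (simp add: zero_less_mult_iff)
      then show "\<exists>j\<in>{1..k - 2}. (b - a) mod n = 1 + int j * int t"
        using c d top[of "nat c"] by (intro bexI[of _ "nat c"]) (auto simp: diag_def)
    qed
    finally show ?thesis .
  qed
  then show ?thesis
    unfolding adj_def n_def[symmetric] by (simp add: GA'_def Let_def n_def)
qed

theorem lemma4p2:
  fixes t k n :: nat
  assumes "t \<ge> 1" and "k \<ge> 4" and "n = t * (k - 1) + 2"
  shows "induced_matching_number (GA' t k) = t \<and>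
         real (card {H. induced_matching (GA' t k) t H})
           = real n / 2 * (real t * (real k - 3) + 1)"
proof -
  let ?G = "GA' t k"
  interpret polygon_diagonals "int t" "int (k - 1)" "int n"
    using assms by unfold_locales auto
  have graph: "pair_graph ?G"
    using assms by (intro pair_graph_GA') auto
  have verts: "pverts ?G = {0..<int n}"
    by (simp add: GA'_def Let_def assms(3))
  have match: "induces_matching (\<lambda>a b. (a, b) \<in> parcs ?G) V \<longleftrightarrow> induces_matching adj V"
    if "V \<subseteq> {0..<int n}" for V
    using that assms GA'_arcs_iff[of t k] verts unfolding induces_matching_def
    by (intro ball_cong refl arg_cong[of _ _ Ex1] ext) (auto simp flip: assms(3))
  have upper: "m \<le> t" if "induced_matching ?G m H" for m H
    using that card_matching_le[of "pverts H"] match[of "pverts H"]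
    by (simp add: induced_matching_iff_vertex_set[OF graph] verts)
  have "{V. V \<subseteq> pverts ?G \<and> induces_matching (\<lambda>a b. (a, b) \<in> parcs ?G) V \<and> card V = 2 * t} =
      {V. V \<subseteq> {0..<int n} \<and> induces_matching adj V \<and> int (card V) = 2 * int t}"
    using match verts by auto
  then have "2 * int (card {H. induced_matching ?G t H}) = int n * (int n - 2 * int t - 1)"
    using card_full_matchings card_induced_matchings[OF graph, of t] by simp
  from arg_cong[OF this, of real_of_int]
  have "2 * real (card {H. induced_matching ?G t H}) = real n * (real n - 2 * real t - 1)"
    by simp
  moreover have "real n - 2 * real t - 1 = real t * (real k - 3) + 1"
    using assms by (simp add: of_nat_diff algebra_simps)
  ultimately have count: "real (card {H. induced_matching ?G t H}) =
      real n / 2 * (real t * (real k - 3) + 1)"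
    by simp
  moreover have "0 < real n / 2 * (real t * (real k - 3) + 1)"
    using assms by (intro mult_pos_pos add_nonneg_pos mult_nonneg_nonneg) (auto simp del: of_nat_mult)
  ultimately have "{H. induced_matching ?G t H} \<noteq> {}"
    by (metis card.empty of_nat_0 less_irrefl)
  then obtain H where "induced_matching ?G t H"
    by blast
  moreover have "finite {m. \<exists>H. induced_matching ?G m H}"
    by (rule finite_subset[of _ "{..t}"]) (use upper in auto)
  ultimately have "induced_matching_number ?G = t"
    unfolding induced_matching_number_def using upper by (intro Max_eqI) auto
  then show ?thesis
    using count by simp
qed

end
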